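(* Let $d\ge 2$. For every four-cycle free graph $\mathcal{H}$, the hom-shift $X_{\mathcal{H}}$ has the pivot property: for all distinct $x,y\in X_{\mathcal{H}}$ which differ at only finitely many sites of $\mathbb{Z}^d$, there is a finite sequence $x=x^{(1)},x^{(2)},\ldots,x^{(k)}=y$ of elements of $X_{\mathcal{H}}$ such that, for each $i$, $x^{(i)}$ and $x^{(i+1)}$ differ at exactly one site.
   Context: Fix $d\ge 2$. $\mathbb{Z}^d$ is also regarded as a graph, with $\vec i\sim\vec j$ iff $\|\vec i-\vec j\|_1=1$. All graphs $\mathcal{H}$ are undirected, without multiple edges and without isolated vertices; the vertex set is also denoted $\mathcal{H}$ and adjacency $\sim_{\mathcal{H}}$. A graph is four-cycle free if it is finite, has no self-loops, and does not contain the 4-cycle $C_4$ as a subgraph (not necessarily induced). It is not assumed to be connected. The hom-shift is $X_{\mathcal{H}}=\{x\in\mathcal{H}^{\mathbb{Z}^d} : x_{\vec i}\sim_{\mathcal{H}}x_{\vec j}\text{ for all }\vec i\sim\vec j\}$. *)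

theory Defs
  imports "HOL-Analysis.Finite_Cartesian_Product" "Graph_Theory.Pair_Digraph"
begin

text \<open>
  An undirected graph without multiple edges is a symmetric digraph whose arcs are ordered
  pairs of vertices, so that u and v are adjacent iff (u, v) is in parcs H.  The locale
  \<^locale>\<open>pair_graph\<close> moreover requires finiteness and the absence of self-loops.
  The group of integer vectors with d coordinates is the type int ^ 'd, with d = CARD('d).
\<close>

definition no_isolated_vertices :: "'v pair_pre_digraph \<Rightarrow> bool" where
  "no_isolated_vertices H \<longleftrightarrow> (\<forall>v \<in> pverts H. \<exists>w \<in> pverts H. (v, w) \<in> parcs H)"

definition cycle4 :: "nat pair_pre_digraph" where
  "cycle4 = \<lparr> pverts = {0..<4},
              parcs = {(i, j). i < 4 \<and> j < 4 \<and> (j = (i + 1) mod 4 \<or> i = (j + 1) mod 4)} \<rparr>"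

text \<open>Subgraph containment up to isomorphism; the copy need not be induced.\<close>

definition contains_subgraph :: "'v pair_pre_digraph \<Rightarrow> 'u pair_pre_digraph \<Rightarrow> bool" where
  "contains_subgraph H F \<longleftrightarrow>
     (\<exists>f. inj_on f (pverts F) \<and> f ` pverts F \<subseteq> pverts H \<and>
          (\<forall>u v. (u, v) \<in> parcs F \<longrightarrow> (f u, f v) \<in> parcs H))"

definition four_cycle_free :: "'v pair_pre_digraph \<Rightarrow> bool" where
  "four_cycle_free H \<longleftrightarrow>
     pair_graph H \<and> no_isolated_vertices H \<and> \<not> contains_subgraph H cycle4"

definition lattice_adj :: "int ^ 'd \<Rightarrow> int ^ 'd \<Rightarrow> bool" where
  "lattice_adj i j \<longleftrightarrow> (\<Sum>k\<in>UNIV. \<bar>i $ k - j $ k\<bar>) = 1"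

definition hom_shift :: "'v pair_pre_digraph \<Rightarrow> (int ^ 'd \<Rightarrow> 'v) set" where
  "hom_shift H =
     {x. (\<forall>i. x i \<in> pverts H) \<and> (\<forall>i j. lattice_adj i j \<longrightarrow> (x i, x j) \<in> parcs H)}"

definition diff_sites :: "('s \<Rightarrow> 'v) \<Rightarrow> ('s \<Rightarrow> 'v) \<Rightarrow> 's set" where
  "diff_sites x y = {i. x i \<noteq> y i}"

definition pivot_property :: "('s \<Rightarrow> 'v) set \<Rightarrow> bool" where
  "pivot_property X \<longleftrightarrow>
     (\<forall>x \<in> X. \<forall>y \<in> X. x \<noteq> y \<and> finite (diff_sites x y) \<longrightarrow>
        (\<exists>k::nat. \<exists>z. 1 \<le> k \<and> z 1 = x \<and> z k = y \<and> (\<forall>n \<in> {1..k}. z n \<in> X) \<and>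
           (\<forall>n \<in> {1..<k}. card (diff_sites (z n) (z (n + 1))) = 1)))"

lemma contains_cycle4_iff:
  assumes "pair_graph H"
  shows "contains_subgraph H cycle4 \<longleftrightarrow>
    (\<exists>a b c d. distinct [a, b, c, d] \<and>
       (a, b) \<in> parcs H \<and> (b, c) \<in> parcs H \<and> (c, d) \<in> parcs H \<and> (d, a) \<in> parcs H)"
proof -
  interpret pair_graph H by fact
  have sy: "(v, u) \<in> parcs H" if "(u, v) \<in> parcs H" for u v
    using pair_sym_arcs that by (simp add: symmetric_def sym_def)
  have less4: "i < 4 \<longleftrightarrow> i = 0 \<or> i = 1 \<or> i = 2 \<or> i = 3" for i :: nat by auto
  show ?thesis
  proof
    assume "contains_subgraph H cycle4"
    then obtain f where f: "inj_on f {0..<4::nat}"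
      "\<And>u v. (u, v) \<in> parcs cycle4 \<Longrightarrow> (f u, f v) \<in> parcs H"
      by (auto simp: contains_subgraph_def cycle4_def)
    have "distinct [f 0, f 1, f 2, f 3]"
      by (simp add: inj_on_eq_iff[OF f(1)])
    moreover have "(f 0, f 1) \<in> parcs H" "(f 1, f 2) \<in> parcs H"
      "(f 2, f 3) \<in> parcs H" "(f 3, f 0) \<in> parcs H"
      by (rule f(2), simp add: cycle4_def)+
    ultimately show "\<exists>a b c d. distinct [a, b, c, d] \<and>
       (a, b) \<in> parcs H \<and> (b, c) \<in> parcs H \<and> (c, d) \<in> parcs H \<and> (d, a) \<in> parcs H"
      by blast
  next
    assume "\<exists>a b c d. distinct [a, b, c, d] \<and>
       (a, b) \<in> parcs H \<and> (b, c) \<in> parcs H \<and> (c, d) \<in> parcs H \<and> (d, a) \<in> parcs H"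
    then obtain a b c d where h: "distinct [a, b, c, d]"
       "(a, b) \<in> parcs H" "(b, c) \<in> parcs H" "(c, d) \<in> parcs H" "(d, a) \<in> parcs H"
      by blast
    define f where "f = (\<lambda>i::nat. [a, b, c, d] ! i)"
    have f: "f 0 = a" "f (Suc 0) = b" "f 2 = c" "f 3 = d" "f (Suc (Suc 0)) = c"
      by (simp_all add: f_def numeral_2_eq_2 numeral_3_eq_3)
    have "inj_on f (pverts cycle4)"
      using h(1) f by (auto simp: inj_on_def cycle4_def less4)
    moreover have "f ` pverts cycle4 \<subseteq> pverts H"
      using f h(2-) by (auto simp: cycle4_def less4 dest: in_arcsD1)
    moreover have "\<forall>u v. (u, v) \<in> parcs cycle4 \<longrightarrow> (f u, f v) \<in> parcs H"
      using f h(2-) sy by (auto simp: cycle4_def less4)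
    ultimately show "contains_subgraph H cycle4"
      unfolding contains_subgraph_def by blast
  qed
qed

end

theory Submission
  imports Defs
begin

text \<open>
  Lift configurations to the universal cover of H, whose vertices are the non-backtracking walks
  in H. Since H has no four-cycle, the image of each lattice square is a degenerate closed walk of
  length four, so lifts exist; as the dimension is at least 2, lifts of two configurations that
  differ at finitely many sites can be chosen to differ at finitely many sites.
  Among the sites where the two lifts differ, take one where one of the lifts is furthest from the
  root. There all the neighbouring values are the parent of that value, so the value may be
  replaced, either by the value of the other lift or by its own grandparent, and the total distance
  from the root over the sites of disagreement drops.
\<close>

section \<open>The lattice\<close>

definition upd :: "int ^ 'd \<Rightarrow> 'd \<Rightarrow> int \<Rightarrow> int ^ 'd" where
  "upd i k t = (\<chi> l. if l = k then t else i $ l)"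

lemma upd_nth [simp]: "upd i k t $ l = (if l = k then t else i $ l)"
  by (simp add: upd_def)

lemma upd_upd [simp]: "upd (upd i k s) k t = upd i k t"
  by (simp add: vec_eq_iff)

lemma upd_same [simp]: "upd i k (i $ k) = i"
  by (simp add: vec_eq_iff)

lemma upd_commute: "k \<noteq> l \<Longrightarrow> upd (upd i k s) l t = upd (upd i l t) k s"
  by (simp add: vec_eq_iff)

lemma lattice_adj_sym: "lattice_adj i j \<longleftrightarrow> lattice_adj j i"
  by (simp add: lattice_adj_def abs_minus_commute)

lemma lattice_adj_upd:
  fixes i :: "int ^ 'd::finite"
  shows "lattice_adj (upd i k t) (upd i k (t + 1))"
proof -
  have "(\<Sum>l\<in>UNIV. \<bar>upd i k t $ l - upd i k (t + 1) $ l\<bar>) = (\<Sum>l\<in>UNIV. if l = k then 1 else 0)"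
    by (rule sum.cong) auto
  then show ?thesis
    by (simp add: lattice_adj_def)
qed

lemma lattice_adj_succ: "lattice_adj i (upd i k (i $ k + 1))"
  using lattice_adj_upd[of i k "i $ k"] by simp

lemma lattice_adjE:
  fixes i j :: "int ^ 'd::finite"
  assumes "lattice_adj i j"
  obtains k where "j = upd i k (i $ k + 1)" | k where "i = upd j k (j $ k + 1)"
proof -
  have s: "(\<Sum>l\<in>UNIV. \<bar>i $ l - j $ l\<bar>) = 1"
    using assms by (simp add: lattice_adj_def)
  then obtain k where k: "\<bar>i $ k - j $ k\<bar> \<noteq> 0"
    by (metis (no_types, lifting) sum.neutral zero_neq_one)
  have "\<bar>i $ k - j $ k\<bar> + (\<Sum>l\<in>UNIV - {k}. \<bar>i $ l - j $ l\<bar>) = 1"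
    using s by (subst (asm) sum.remove[of _ k]) auto
  moreover have "(\<Sum>l\<in>UNIV - {k}. \<bar>i $ l - j $ l\<bar>) \<ge> 0"
    by (rule sum_nonneg) simp
  ultimately have one: "\<bar>i $ k - j $ k\<bar> = 1" and "(\<Sum>l\<in>UNIV - {k}. \<bar>i $ l - j $ l\<bar>) = 0"
    using k by linarith+
  then have eq: "i $ l = j $ l" if "l \<noteq> k" for l
    using that by (subst (asm) sum_nonneg_eq_0_iff) auto
  show thesis
  proof (cases "j $ k = i $ k + 1")
    case True
    then show thesis
      using eq by (intro that(1)[of k]) (auto simp: vec_eq_iff)
  next
    case False
    then have "i $ k = j $ k + 1" using one by linarith
    then show thesis
      using eq by (intro that(2)[of k]) (auto simp: vec_eq_iff)
  qed
qed

section \<open>Propagation along lines and coordinates\<close>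

lemma line_propagate:
  assumes step: "\<And>t. P (upd i k t) \<longleftrightarrow> P (upd i k (t + 1))"
  shows "P (upd i k s) \<longleftrightarrow> P (upd i k t)"
proof (induction t rule: int_induct[where k = s])
  case base
  show ?case ..
next
  case (step1 t)
  then show ?case using step[of t] by simp
next
  case (step2 t)
  then show ?case using step[of "t - 1"] by simp
qed

text \<open>Coordinates are replaced one at a time by those of \<open>b\<close>. The invariant
  \<open>C\<close> confines the path to the region in which \<open>P\<close> is known to
  propagate.\<close>

lemma coordinates_propagate:
  fixes b i :: "int ^ 'd::finite"
  assumes "\<And>i k t. k \<in> A \<Longrightarrow> C i \<Longrightarrow> C (upd i k t) \<and> (P (upd i k t) \<longleftrightarrow> P i)" and "C i"
  shows "C (\<chi> l. if l \<in> A then b $ l else i $ l) \<and>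
    (P (\<chi> l. if l \<in> A then b $ l else i $ l) \<longleftrightarrow> P i)"
  using finite[of A] assms(1)
proof (induction A rule: finite_induct)
  case empty
  then show ?case using assms(2) by simp
next
  case (insert k A)
  let ?j = "\<chi> l. if l \<in> A then b $ l else i $ l"
  have "C ?j \<and> (P ?j \<longleftrightarrow> P i)"
    using insert.IH insert.prems by blast
  moreover have "(\<chi> l. if l \<in> insert k A then b $ l else i $ l) = upd ?j k (b $ k)"
    by (simp add: vec_eq_iff)
  ultimately show ?case
    using insert.prems[of k ?j "b $ k"] by simp
qed

text \<open>Connectedness of the lattice: \<open>b\<close> is reached from any site by changing the
  coordinates one after another.\<close>

lemma lattice_induct:
  fixes b i :: "int ^ 'd::finite"
  assumes "P b" and adj: "\<And>i j. lattice_adj i j \<Longrightarrow> P i \<Longrightarrow> P j"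
  shows "P i"
proof -
  have "P (upd i k t) \<longleftrightarrow> P i" for i k t
    using line_propagate[of P i k t "i $ k"] adj lattice_adj_upd lattice_adj_sym by (metis upd_same)
  then show ?thesis
    using coordinates_propagate[of UNIV "\<lambda>_. True" P i b] assms(1) by simp
qed

section \<open>Boxes and their exteriors\<close>

lemma finite_bounded_coordinates:
  fixes D :: "(int ^ 'd::finite) set"
  assumes "finite D"
  shows "\<exists>N. \<forall>i\<in>D. \<forall>k. \<bar>i $ k\<bar> \<le> N"
proof -
  let ?f = "\<lambda>(i, k). \<bar>i $ k\<bar>"
  have "\<bar>i $ k\<bar> \<le> Max (?f ` (D \<times> UNIV))" if "i \<in> D" for i k
    using assms that by (intro Max_ge) auto
  then show ?thesis by blast
qed

lemma finite_box: "finite {i :: int ^ 'd::finite. \<forall>k. \<bar>i $ k\<bar> \<le> N}"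
proof -
  have "{i :: int ^ 'd. \<forall>k. \<bar>i $ k\<bar> \<le> N} \<subseteq> vec_lambda ` (UNIV \<rightarrow>\<^sub>E {-N..N})"
  proof
    fix i :: "int ^ 'd"
    assume "i \<in> {i. \<forall>k. \<bar>i $ k\<bar> \<le> N}"
    then have "vec_nth i \<in> UNIV \<rightarrow>\<^sub>E {-N..N}"
      by (auto simp: abs_le_iff minus_le_iff)
    then show "i \<in> vec_lambda ` (UNIV \<rightarrow>\<^sub>E {-N..N})"
      by (metis image_eqI vec_nth_inverse)
  qed
  then show ?thesis
    by (rule finite_subset) (intro finite_imageI finite_PiE, auto)
qed

text \<open>The exterior of a box is connected once there are two directions: while coordinate
  \<open>k\<close> is beyond \<open>N\<close> in absolute value, all others move freely to
  \<open>\<bar>N\<bar> + 1\<close>; one of them, now beyond \<open>N\<close> itself, then frees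
  coordinate \<open>k\<close>.\<close>

lemma exterior_propagate:
  fixes i :: "int ^ 'd::finite"
  assumes card: "CARD('d) \<ge> 2"
    and ext: "\<And>i j. lattice_adj i j \<Longrightarrow> \<exists>k. \<bar>i $ k\<bar> > N \<Longrightarrow> \<exists>k. \<bar>j $ k\<bar> > N \<Longrightarrow> P i \<Longrightarrow> P j"
    and base: "P (\<chi> k. \<bar>N\<bar> + 1)" and i: "\<exists>k. \<bar>i $ k\<bar> > N"
  shows "P i"
proof -
  have line: "P (upd i k t) \<longleftrightarrow> P i" if "l \<noteq> k" "\<bar>i $ l\<bar> > N" for i :: "int ^ 'd" and k l t
  proof -
    have out: "\<exists>m. \<bar>upd i k s $ m\<bar> > N" for s
      using that by (intro exI[of _ l]) simp
    have "P (upd i k s) \<longleftrightarrow> P (upd i k (s + 1))" for s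
      using ext out lattice_adj_upd lattice_adj_sym by metis
    then show ?thesis
      using line_propagate[of P i k t "i $ k"] by simp
  qed
  obtain k where k: "\<bar>i $ k\<bar> > N" using i by blast
  have "UNIV \<noteq> {k}" using card by (auto dest: arg_cong[of _ _ card])
  then obtain l where l: "l \<noteq> k" by blast
  let ?b = "\<chi> k. \<bar>N\<bar> + 1" and ?j = "\<chi> l. if l \<in> - {k} then (\<chi> k. \<bar>N\<bar> + 1) $ l else i $ l"
  have "P ?j \<longleftrightarrow> P i"
    by (rule coordinates_propagate[of "- {k}" "\<lambda>i. \<bar>i $ k\<bar> > N" P i ?b, THEN conjunct2])
      (use line[of k] k in auto)
  moreover have "P (upd ?j k (\<bar>N\<bar> + 1)) \<longleftrightarrow> P ?j"
    using l by (intro line[of l]) auto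
  moreover have "upd ?j k (\<bar>N\<bar> + 1) = ?b"
    by (simp add: vec_eq_iff)
  ultimately show ?thesis using base by simp
qed

section \<open>The universal cover\<close>

text \<open>Four-cycle freeness in the form used: without loops, consecutive vertices of a closed
  walk of length four differ, so only a coincidence of opposite vertices keeps it from being a
  four-cycle.\<close>

locale four_cycle_free_graph = pair_graph H for H :: "'v pair_pre_digraph" (structure) +
  assumes square: "\<lbrakk>(a, b) \<in> parcs H; (b, c) \<in> parcs H; (c, d) \<in> parcs H; (d, a) \<in> parcs H\<rbrakk>
    \<Longrightarrow> a = c \<or> b = d"
begin

lemma arc_sym: "(u, v) \<in> parcs H \<Longrightarrow> (v, u) \<in> parcs H"
  using pair_sym_arcs by (simp add: symmetric_def sym_def)

text \<open>A vertex of the cover is a walk listed backwards: the head is its projection to H, the tail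
  its parent, and the last entry the root.\<close>

fun reduced_walk :: "'v list \<Rightarrow> bool" where
  "reduced_walk [] \<longleftrightarrow> False"
| "reduced_walk [v] \<longleftrightarrow> v \<in> pverts H"
| "reduced_walk (u # v # p) \<longleftrightarrow>
     (u, v) \<in> parcs H \<and> (p = [] \<or> hd p \<noteq> u) \<and> reduced_walk (v # p)"

text \<open>Parent-child adjacency; since both walks must be reduced, the empty tail of a root does
  not count. Each vertex of \<open>H\<close> is the root of its own tree, the universal cover of its
  component.\<close>

definition cover_adj :: "'v list \<Rightarrow> 'v list \<Rightarrow> bool" where
  "cover_adj p q \<longleftrightarrow> reduced_walk p \<and> reduced_walk q \<and> (tl p = q \<or> tl q = p)"

lemma cover_adj_sym: "cover_adj p q \<Longrightarrow> cover_adj q p"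
  by (auto simp: cover_adj_def)

lemma reduced_walk_hd: "reduced_walk p \<Longrightarrow> hd p \<in> pverts H"
  by (induction p rule: reduced_walk.induct) (auto dest: in_arcsD1)

lemma reduced_walk_tl: "reduced_walk p \<Longrightarrow> tl p \<noteq> [] \<Longrightarrow> reduced_walk (tl p)"
  by (cases p rule: reduced_walk.cases) auto

lemma cover_adj_cases:
  assumes "cover_adj p q"
  obtains u v r where "p = u # v # r" "q = v # r" "reduced_walk p"
  | u v r where "q = u # v # r" "p = v # r" "reduced_walk q"
  using assms unfolding cover_adj_def
  by (cases p rule: reduced_walk.cases; cases q rule: reduced_walk.cases) auto

lemma cover_adj_hd: "cover_adj p q \<Longrightarrow> (hd p, hd q) \<in> parcs H"
  by (erule cover_adj_cases) (auto intro: arc_sym)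

lemma cover_adj_last: "cover_adj p q \<Longrightarrow> last p = last q"
  by (erule cover_adj_cases) auto

lemma cover_adj_parity: "cover_adj p q \<Longrightarrow> even (length p) \<longleftrightarrow> odd (length q)"
  by (erule cover_adj_cases) auto

text \<open>Projection is injective on neighbourhoods: distinct children of \<open>p\<close> have
  distinct heads, and reducedness separates the head of the parent from those of the
  children.\<close>

lemma cover_adj_unique:
  assumes "cover_adj p q" "cover_adj p q'" "hd q = hd q'"
  shows "q = q'"
  using assms(1)
proof (cases rule: cover_adj_cases)
  case 1
  with assms(2,3) show ?thesis by (elim cover_adj_cases) auto
next
  case 2
  with assms(2,3) show ?thesis by (elim cover_adj_cases) auto
qed

text \<open>Lifts the step from \<open>hd p\<close> to \<open>w\<close>: a step back to the parent
  cancels instead of extending the walk, which keeps it reduced. A root has no parent, hence the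
  guard on \<open>tl p\<close>.\<close>

definition move :: "'v \<Rightarrow> 'v list \<Rightarrow> 'v list" where
  "move w p = (if tl p \<noteq> [] \<and> hd (tl p) = w then tl p else w # p)"

lemma cover_adj_move:
  assumes "reduced_walk p" "(hd p, w) \<in> parcs H"
  shows "cover_adj p (move w p)" "hd (move w p) = w"
  using assms by (cases p rule: reduced_walk.cases; auto simp: cover_adj_def move_def arc_sym)+

text \<open>The heads form a closed walk of length four, so two opposite ones coincide, and unique
  lifting gives \<open>a = d\<close> or \<open>b = c\<close>. Either way the fourth side is one of
  the three given sides.\<close>

lemma cover_square:
  assumes "cover_adj a b" "cover_adj a c" "cover_adj c d" "(hd b, hd d) \<in> parcs H"
  shows "cover_adj b d"
proof -
  have "hd a = hd d \<or> hd b = hd c"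
    using square[of "hd a" "hd b" "hd d" "hd c"] assms cover_adj_hd arc_sym by metis
  then show ?thesis
    using cover_adj_unique[of c a d] cover_adj_unique[of a b c] assms cover_adj_sym by metis
qed

section \<open>Lifting of paths\<close>

primrec lift_ray :: "(nat \<Rightarrow> 'v) \<Rightarrow> 'v list \<Rightarrow> nat \<Rightarrow> 'v list" where
  "lift_ray g p 0 = p"
| "lift_ray g p (Suc n) = move (g (Suc n)) (lift_ray g p n)"

lemma lift_ray:
  assumes "reduced_walk p" "hd p = g 0" "\<And>n. (g n, g (Suc n)) \<in> parcs H"
  shows "cover_adj (lift_ray g p n) (lift_ray g p (Suc n)) \<and> hd (lift_ray g p n) = g n"
proof -
  have "reduced_walk (lift_ray g p n) \<and> hd (lift_ray g p n) = g n"
  proof (induction n)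
    case 0
    then show ?case using assms by simp
  next
    case (Suc n)
    then show ?case
      using cover_adj_move[of "lift_ray g p n" "g (Suc n)"] assms(3)[of n]
      by (simp add: cover_adj_def)
  qed
  then show ?thesis
    using cover_adj_move[of "lift_ray g p n" "g (Suc n)"] assms(3)[of n] by simp
qed

definition lift_line :: "int \<Rightarrow> (int \<Rightarrow> 'v) \<Rightarrow> 'v list \<Rightarrow> int \<Rightarrow> 'v list" where
  "lift_line s g p t =
     (if t \<ge> s then lift_ray (\<lambda>n. g (s + int n)) p (nat (t - s))
      else lift_ray (\<lambda>n. g (s - int n)) p (nat (s - t)))"

lemma lift_line_base: "lift_line s g p s = p"
  by (simp add: lift_line_def)

lemma lift_line:
  assumes "reduced_walk p" "hd p = g s" and g: "\<And>t. (g t, g (t + 1)) \<in> parcs H"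
  shows "cover_adj (lift_line s g p t) (lift_line s g p (t + 1))" "hd (lift_line s g p t) = g t"
proof -
  have up: "(g (s + int n), g (s + int (Suc n))) \<in> parcs H" for n
    using g[of "s + int n"] by (simp add: algebra_simps)
  have down: "(g (s - int n), g (s - int (Suc n))) \<in> parcs H" for n
    using arc_sym[OF g[of "s - int n - 1"]] by (simp add: algebra_simps)
  note up = lift_ray[of p "\<lambda>n. g (s + int n)", OF assms(1) _ up]
  note down = lift_ray[of p "\<lambda>n. g (s - int n)", OF assms(1) _ down]
  show "hd (lift_line s g p t) = g t"
    using up down assms(2) by (auto simp: lift_line_def)
  show "cover_adj (lift_line s g p t) (lift_line s g p (t + 1))"
  proof (cases "t \<ge> s")
    case True
    then have "nat (t + 1 - s) = Suc (nat (t - s))" by simp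
    then show ?thesis
      using True up[of "nat (t - s)"] assms(2) by (simp add: lift_line_def del: lift_ray.simps(2))
  next
    case False
    then have n: "nat (s - t) = Suc (nat (s - (t + 1)))" by simp
    have "lift_line s g p (t + 1) = lift_ray (\<lambda>n. g (s - int n)) p (nat (s - (t + 1)))"
      using False by (auto simp: lift_line_def)
    moreover have "lift_line s g p t = lift_ray (\<lambda>n. g (s - int n)) p (Suc (nat (s - (t + 1))))"
      using False n by (simp add: lift_line_def del: lift_ray.simps(2))
    ultimately show ?thesis
      using down[of "nat (s - (t + 1))"] assms(2) by (simp add: cover_adj_sym del: lift_ray.simps(2))
  qed
qed

section \<open>Lifts of configurations\<close>

definition is_lift :: "(int ^ 'd::finite \<Rightarrow> 'v list) \<Rightarrow> bool" where
  "is_lift X \<longleftrightarrow> (\<forall>i j. lattice_adj i j \<longrightarrow> cover_adj (X i) (X j))"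

lemma is_lift_reduced: "is_lift X \<Longrightarrow> reduced_walk (X i)"
  using lattice_adj_succ[of i] by (auto simp: is_lift_def cover_adj_def)

lemma is_lift_hom_shift: "is_lift X \<Longrightarrow> hd \<circ> X \<in> hom_shift H"
  using is_lift_reduced[of X] reduced_walk_hd cover_adj_hd by (auto simp: hom_shift_def is_lift_def)

text \<open>Induction on the set \<open>A\<close> of directions in which adjacency is already
  secured; each new direction is lifted line by line.\<close>

lemma hom_shift_lift_directions:
  fixes x :: "int ^ 'd::finite \<Rightarrow> 'v" and A :: "'d set"
  assumes x: "x \<in> hom_shift H" and p: "reduced_walk p" "hd p = x b"
  shows "\<exists>X. X b = p \<and> (\<forall>i. reduced_walk (X i) \<and> hd (X i) = x i) \<and>
    (\<forall>k\<in>A. \<forall>i. cover_adj (X i) (X (upd i k (i $ k + 1))))"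
  using finite[of A]
proof (induction A rule: finite_induct)
  case empty
  have "x i \<in> pverts H" for i
    using x by (simp add: hom_shift_def)
  \<comment> \<open>With no adjacency required, trivial walks suffice away from
    \<open>b\<close>.\<close>
  then show ?case
    using p by (intro exI[of _ "\<lambda>i. if i = b then p else [x i]"]) auto
next
  case (insert k A)
  then obtain X where X: "X b = p" "\<And>i. reduced_walk (X i)" "\<And>i. hd (X i) = x i"
    "\<And>l i. l \<in> A \<Longrightarrow> cover_adj (X i) (X (upd i l (i $ l + 1)))"
    by blast
  have arc: "lattice_adj i j \<Longrightarrow> (x i, x j) \<in> parcs H" for i j
    using x by (simp add: hom_shift_def)
  \<comment> \<open>\<open>X\<close> is kept only on the hyperplane through \<open>b\<close>
    orthogonal to direction \<open>k\<close>; each line in direction \<open>k\<close> is lifted anew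
    from its point there.\<close>
  define Y where "Y i = lift_line (b $ k) (\<lambda>t. x (upd i k t)) (X (upd i k (b $ k))) (i $ k)" for i
  have Y_line: "Y (upd i k t) =
      lift_line (b $ k) (\<lambda>t. x (upd i k t)) (X (upd i k (b $ k))) t" for i t
    by (simp add: Y_def)
  have Yk: "cover_adj (Y (upd i k t)) (Y (upd i k (t + 1)))" for i t
    unfolding Y_line using X(2,3) by (intro lift_line) (auto intro: arc lattice_adj_upd)
  have Y_hd: "hd (Y i) = x i" for i
    using lift_line(2)[of "X (upd i k (b $ k))" "\<lambda>t. x (upd i k t)" "b $ k" "i $ k"]
      X(2,3) arc[OF lattice_adj_upd] unfolding Y_def by simp
  have Y_red: "reduced_walk (Y i)" for i
    using Yk[of i "i $ k"] by (simp add: cover_adj_def)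
  have Y_base: "Y (upd i k (b $ k)) = X (upd i k (b $ k))" for i
    by (simp add: Y_line lift_line_base)
  have Yl: "cover_adj (Y i) (Y (upd i l (i $ l + 1)))" if l: "l \<in> A" for i l
  proof -
    have lk: "l \<noteq> k" using l insert.hyps by blast
    let ?j = "upd i l (i $ l + 1)"
    have x_rung: "(x (upd i k t), x (upd ?j k t)) \<in> parcs H" for t
    proof -
      have "upd ?j k t = upd (upd i k t) l (upd i k t $ l + 1)"
        using lk by (simp add: upd_commute)
      then show ?thesis using arc lattice_adj_succ by metis
    qed
    \<comment> \<open>Two parallel lines form a ladder. Its rung at \<open>b $ k\<close> comes from
      \<open>X\<close>, and \<open>cover_square\<close> carries adjacency from rung to rung both
      ways.\<close>
    have "cover_adj (Y (upd i k t)) (Y (upd ?j k t))" for t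
    proof (induction t rule: int_induct[where k = "b $ k"])
      case base
      have "upd ?j k (b $ k) = upd (upd i k (b $ k)) l (upd i k (b $ k) $ l + 1)"
        using lk by (simp add: upd_commute)
      then show ?case
        unfolding Y_base using X(4)[OF l, of "upd i k (b $ k)"] by simp
    next
      case (step1 t)
      then show ?case
        using cover_square[OF Yk step1(2) Yk] x_rung by (simp add: Y_hd)
    next
      case (step2 t)
      have "cover_adj (Y (upd m k t)) (Y (upd m k (t - 1)))" for m
        using cover_adj_sym[OF Yk[of m "t - 1"]] by simp
      then show ?case
        using cover_square[of "Y (upd i k t)" "Y (upd i k (t - 1))" "Y (upd ?j k t)"
            "Y (upd ?j k (t - 1))"] step2(2) x_rung by (simp add: Y_hd)
    qed
    from this[of "i $ k"] show ?thesis
      using lk upd_same[of ?j k] by simp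
  qed
  have "Y b = p"
    using Y_base[of b] X(1) by simp
  moreover have "cover_adj (Y i) (Y (upd i k (i $ k + 1)))" for i
    using Yk[of i "i $ k"] by simp
  ultimately show ?case
    using Y_red Y_hd Yl by (intro exI[of _ Y]) auto
qed

lemma hom_shift_lift:
  fixes x :: "int ^ 'd::finite \<Rightarrow> 'v"
  assumes "x \<in> hom_shift H" "reduced_walk p" "hd p = x b"
  obtains X where "is_lift X" "hd \<circ> X = x" "X b = p"
proof -
  obtain X where X: "X b = p" "\<And>i. hd (X i) = x i"
    "\<And>k i. cover_adj (X i) (X (upd i k (i $ k + 1)))"
    using hom_shift_lift_directions[OF assms, of UNIV] by blast
  have "is_lift X"
    unfolding is_lift_def by (intro allI impI; erule lattice_adjE) (use X(3) cover_adj_sym in auto)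
  then show thesis
    using X by (intro that[of X]) auto
qed

section \<open>Pivot moves\<close>

definition pivot :: "((int ^ 'd::finite \<Rightarrow> 'v) \<times> (int ^ 'd \<Rightarrow> 'v)) set" where
  "pivot = {(x, y). x \<in> hom_shift H \<and> y \<in> hom_shift H \<and> card (diff_sites x y) = 1}"

lemma pivot_sym: "sym pivot"
  by (auto simp: sym_def pivot_def diff_sites_def eq_commute)

lemma pivot_fun_upd:
  assumes X: "is_lift X" and q: "reduced_walk q" "hd q \<noteq> hd (X i)"
    and nbr: "\<And>j. lattice_adj i j \<Longrightarrow> cover_adj q (X j)"
  shows "is_lift (X(i := q))" "(hd \<circ> X, hd \<circ> X(i := q)) \<in> pivot"
proof -
  have "\<not> lattice_adj i i" by (simp add: lattice_adj_def)
  then show lift: "is_lift (X(i := q))"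
    using X nbr cover_adj_sym lattice_adj_sym unfolding is_lift_def by (metis fun_upd_apply)
  have "diff_sites (hd \<circ> X) (hd \<circ> X(i := q)) = {i}"
    using q(2) by (auto simp: diff_sites_def)
  then show "(hd \<circ> X, hd \<circ> X(i := q)) \<in> pivot"
    using is_lift_hom_shift[OF X] is_lift_hom_shift[OF lift] by (simp add: pivot_def)
qed

text \<open>The termination measure. Both lengths count, so that a move of either lift can lower
  it.\<close>

definition weight :: "(int ^ 'd::finite \<Rightarrow> 'v list) \<Rightarrow> (int ^ 'd \<Rightarrow> 'v list) \<Rightarrow> nat" where
  "weight X Y = (\<Sum>i\<in>diff_sites X Y. length (X i) + length (Y i))"

lemma diff_sites_commute: "diff_sites X Y = diff_sites Y X"
  by (auto simp: diff_sites_def)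

lemma weight_commute: "weight X Y = weight Y X"
  by (simp add: weight_def diff_sites_commute[of X] add.commute)

text \<open>Either site \<open>i\<close> leaves the disagreement and its positive contribution
  vanishes, or it stays with a smaller contribution; no other term changes.\<close>

lemma weight_fun_upd_less:
  assumes fin: "finite (diff_sites X Y)" and i: "i \<in> diff_sites X Y"
    and less: "q = Y i \<and> X i \<noteq> [] \<or> length q < length (X i)"
  shows "weight (X(i := q)) Y < weight X Y" "finite (diff_sites (X(i := q)) Y)"
proof -
  let ?D = "diff_sites X Y" and ?X = "X(i := q)"
  have sub: "diff_sites ?X Y \<subseteq> ?D"
    using i by (auto simp: diff_sites_def split: if_splits)
  then show "finite (diff_sites ?X Y)"
    using fin finite_subset by blast
  have eq: "(\<Sum>j\<in>?D - {i}. length (?X j) + length (Y j)) = (\<Sum>j\<in>?D - {i}. length (X j) + length (Y j))"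
    by (rule sum.cong) auto
  have total: "weight X Y = length (X i) + length (Y i) + (\<Sum>j\<in>?D - {i}. length (X j) + length (Y j))"
    unfolding weight_def using fin i by (simp add: sum.remove)
  show "weight ?X Y < weight X Y"
  proof (cases "q = Y i")
    case True
    then have "diff_sites ?X Y \<subseteq> ?D - {i}"
      using sub by (auto simp: diff_sites_def)
    then have "weight ?X Y \<le> (\<Sum>j\<in>?D - {i}. length (?X j) + length (Y j))"
      unfolding weight_def using fin by (intro sum_mono2) auto
    moreover have "length (X i) > 0"
      using less True by auto
    ultimately show ?thesis
      using eq total by linarith
  next
    case False
    then have "weight ?X Y \<le> (\<Sum>j\<in>?D. length (?X j) + length (Y j))"
      unfolding weight_def using fin sub by (intro sum_mono2) auto
    also have "\<dots> = length q + length (Y i) + (\<Sum>j\<in>?D - {i}. length (X j) + length (Y j))"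
      using fin i eq by (simp add: sum.remove)
    also have "\<dots> < weight X Y"
      using less False total by auto
    finally show ?thesis .
  qed
qed

lemma pivot_decreases_weight:
  fixes X Y :: "int ^ 'd::finite \<Rightarrow> 'v list"
  assumes X: "is_lift X" and Y: "is_lift Y" and fin: "finite (diff_sites X Y)"
    and root: "last (X i) = last (Y i)" and parity: "even (length (X i)) \<longleftrightarrow> even (length (Y i))"
    and i: "i \<in> diff_sites X Y"
    and max_X: "\<And>j. j \<in> diff_sites X Y \<Longrightarrow> length (X j) \<le> length (X i)"
    and max_Y: "length (Y i) \<le> length (X i)"
  shows "\<exists>X'. is_lift X' \<and> (hd \<circ> X, hd \<circ> X') \<in> pivot \<and> finite (diff_sites X' Y) \<and>
    weight X' Y < weight X Y"
proof -
  let ?p = "tl (X i)"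
  have ne: "X i \<noteq> Y i" using i by (simp add: diff_sites_def)
  have adj_X: "cover_adj (X i) (X j)" and adj_Y: "cover_adj (Y i) (Y j)" if "lattice_adj i j" for j
    using X Y that by (auto simp: is_lift_def)
  \<comment> \<open>A child of \<open>X i\<close> would exceed the maximum, so both lifts agree at
    \<open>j\<close>. Then \<open>Y i\<close>, being no longer than \<open>X i\<close>, is the
    parent of that common value, which is \<open>X i\<close> itself.\<close>
  have nbr: "X j = ?p" if j: "lattice_adj i j" for j
    using adj_X[OF j]
  proof (cases rule: cover_adj_cases)
    case (2 u v r)
    then have "length (X j) > length (X i)" by simp
    with max_X[of j] have "X j = Y j" by (force simp: diff_sites_def)
    with 2 have "Y i = X i"
      using adj_Y[OF j] max_Y by (elim cover_adj_cases) auto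
    then show ?thesis using ne by simp
  qed auto
  have p: "cover_adj (X i) ?p"
    using nbr adj_X lattice_adj_succ by metis
  then obtain u v r where Xi: "X i = u # v # r" and red: "reduced_walk (X i)"
    by (cases "X i" rule: reduced_walk.cases) (auto simp: cover_adj_def)
  \<comment> \<open>All neighbours carry \<open>?p\<close>, so any other neighbour \<open>q\<close>
    of \<open>?p\<close> may replace \<open>X i\<close>: preferably \<open>Y i\<close>, otherwise
    the grandparent.\<close>
  have "\<exists>q. cover_adj q ?p \<and> hd q \<noteq> hd (X i) \<and> (q = Y i \<or> length q < length (X i))"
  proof (cases "cover_adj (Y i) ?p")
    case True
    then have "hd (Y i) \<noteq> hd (X i)"
      using cover_adj_unique[of ?p "Y i" "X i"] p cover_adj_sym ne by metis
    with True show ?thesis by blast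
  next
    case False
    \<comment> \<open>The grandparent exists: if \<open>?p\<close> were the root, equal roots, equal
      parity and maximality would make \<open>Y i\<close> a walk of length one from that root, hence
      adjacent to \<open>?p\<close>.\<close>
    have "r \<noteq> []"
    proof
      assume "r = []"
      moreover have Yi: "reduced_walk (Y i)" by (rule is_lift_reduced[OF Y])
      ultimately have "tl (Y i) = [v]" "length (Y i) = 2"
        using max_Y parity root Xi by (cases "Y i" rule: reduced_walk.cases; force)+
      with False p Xi \<open>r = []\<close> Yi show False by (simp add: cover_adj_def)
    qed
    \<comment> \<open>Reducedness of \<open>X i\<close> separates its head from that of its
      grandparent.\<close>
    then have "cover_adj r ?p \<and> hd r \<noteq> hd (X i)"
      using red Xi reduced_walk_tl[of "v # r"] by (auto simp: cover_adj_def)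
    then show ?thesis using Xi by auto
  qed
  then obtain q where q: "cover_adj q ?p" "hd q \<noteq> hd (X i)" "q = Y i \<or> length q < length (X i)"
    by blast
  then show ?thesis
    using pivot_fun_upd[OF X, of q i] nbr weight_fun_upd_less[OF fin i, of q] Xi
    by (intro exI[of _ "X(i := q)"]) (auto simp: cover_adj_def)
qed

text \<open>Strong induction on the weight. The lift that is longer at a maximal site is moved; a
  move of \<open>Y\<close> is appended in reverse, as pivots are symmetric.\<close>

lemma lifts_pivot_connected:
  fixes X Y :: "int ^ 'd::finite \<Rightarrow> 'v list"
  assumes "is_lift X" "is_lift Y" "finite (diff_sites X Y)"
  shows "(hd \<circ> X, hd \<circ> Y) \<in> pivot\<^sup>*"
  using assms
proof (induction "weight X Y" arbitrary: X Y rule: less_induct)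
  case less
  let ?D = "diff_sites X Y"
  show ?case
  proof (cases "?D = {}")
    case True
    then have "X = Y" by (auto simp: diff_sites_def)
    then show ?thesis by simp
  next
    case False
    obtain N where N: "\<forall>i\<in>?D. \<forall>k. \<bar>i $ k\<bar> \<le> N"
      using finite_bounded_coordinates[OF less.prems(3)] by blast
    let ?b = "(\<chi> k. \<bar>N\<bar> + 1) :: int ^ 'd"
    have "?b \<notin> ?D"
    proof
      assume "?b \<in> ?D"
      \<comment> \<open>\<open>undefined\<close> is merely some direction; every coordinate of
        \<open>?b\<close> exceeds \<open>N\<close>.\<close>
      then have "\<bar>?b $ undefined\<bar> \<le> N" using N by blast
      then show False by simp
    qed
    \<comment> \<open>The lifts agree at \<open>?b\<close>; a lattice step preserves both roots and
      flips both parities.\<close>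
    then have same: "last (X i) = last (Y i) \<and> (even (length (X i)) \<longleftrightarrow> even (length (Y i)))" for i
    proof (induction rule: lattice_induct[where b = ?b])
      case 1
      then show ?case by (simp add: diff_sites_def)
    next
      case (2 i j)
      then have "cover_adj (X i) (X j)" "cover_adj (Y i) (Y j)"
        using less.prems by (auto simp: is_lift_def)
      with 2 show ?case
        using cover_adj_last cover_adj_parity by metis
    qed
    define m where "m i = max (length (X i)) (length (Y i))" for i
    have "Max (m ` ?D) \<in> m ` ?D"
      using less.prems(3) False by (intro Max_in) auto
    then obtain i where i: "i \<in> ?D" and m_max: "m i = Max (m ` ?D)"
      by (metis imageE)
    then have "m j \<le> m i" if "j \<in> ?D" for j
      using that less.prems(3) by simp
    then have max: "length (X j) \<le> m i" "length (Y j) \<le> m i" if "j \<in> ?D" for j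
      using that by (force simp: m_def)+
    show ?thesis
    proof (cases "length (Y i) \<le> length (X i)")
      case True
      then have "m i = length (X i)" by (simp add: m_def)
      then obtain X' where X': "is_lift X'" "(hd \<circ> X, hd \<circ> X') \<in> pivot"
        "finite (diff_sites X' Y)" "weight X' Y < weight X Y"
        using pivot_decreases_weight[OF less.prems, of i] i max(1) same True by metis
      then show ?thesis
        using less.hyps[of X' Y] less.prems(2) by (meson converse_rtrancl_into_rtrancl)
    next
      case False
      then have "m i = length (Y i)" by (simp add: m_def)
      then obtain Y' where Y': "is_lift Y'" "(hd \<circ> Y, hd \<circ> Y') \<in> pivot"
        "finite (diff_sites Y' X)" "weight Y' X < weight Y X"
        using pivot_decreases_weight[of Y X i] less.prems diff_sites_commute[of Y X] i max(2) same False
        by (metis nat_le_linear)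
      then have "(hd \<circ> X, hd \<circ> Y') \<in> pivot\<^sup>*"
        using less.hyps[of X Y'] less.prems(1) weight_commute[of X] diff_sites_commute[of X] by simp
      moreover have "(hd \<circ> Y', hd \<circ> Y) \<in> pivot"
        by (rule symD[OF pivot_sym Y'(2)])
      ultimately show ?thesis by (rule rtrancl_into_rtrancl)
    qed
  qed
qed

lemma hom_shift_pivot_connected:
  fixes x y :: "int ^ 'd::finite \<Rightarrow> 'v"
  assumes card: "CARD('d) \<ge> 2" and x: "x \<in> hom_shift H" and y: "y \<in> hom_shift H"
    and fin: "finite (diff_sites x y)"
  shows "(x, y) \<in> pivot\<^sup>*"
proof -
  obtain N where N: "\<forall>i \<in> diff_sites x y. \<forall>k. \<bar>i $ k\<bar> \<le> N"
    using finite_bounded_coordinates[OF fin] by blast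
  have out: "x i = y i" if "\<exists>k. \<bar>i $ k\<bar> > N" for i
    using that N by (metis (mono_tags) diff_sites_def mem_Collect_eq not_le)
  let ?b = "(\<chi> k. \<bar>N\<bar> + 1) :: int ^ 'd"
  have "x ?b = y ?b" by (intro out) auto
  have "reduced_walk [x ?b]"
    using x by (simp add: hom_shift_def)
  with x y \<open>x ?b = y ?b\<close> obtain X Y where X: "is_lift X" "hd \<circ> X = x" "X ?b = [x ?b]"
    and Y: "is_lift Y" "hd \<circ> Y = y" "Y ?b = [x ?b]"
    using hom_shift_lift[of x "[x ?b]" ?b] hom_shift_lift[of y "[x ?b]" ?b] by (metis list.sel(1))
  \<comment> \<open>Both lifts start from the same trivial walk at \<open>?b\<close>, and
    \<open>x\<close>, \<open>y\<close> agree outside the box, so unique lifting carries equality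
    through the connected exterior.\<close>
  have "X i = Y i" if "\<exists>k. \<bar>i $ k\<bar> > N" for i
  proof (rule exterior_propagate[OF card, of N "\<lambda>i. X i = Y i"])
    fix i j :: "int ^ 'd"
    assume "lattice_adj i j" "\<exists>k. \<bar>j $ k\<bar> > N" "X i = Y i"
    moreover from this have "hd (X j) = hd (Y j)"
      using out X(2) Y(2) by (metis comp_apply)
    ultimately show "X j = Y j"
      using X(1) Y(1) cover_adj_unique unfolding is_lift_def by metis
  qed (use that X(3) Y(3) in auto)
  then have "diff_sites X Y \<subseteq> {i. \<forall>k. \<bar>i $ k\<bar> \<le> N}"
    by (auto simp: diff_sites_def not_less[symmetric])
  then have "finite (diff_sites X Y)"
    using finite_box finite_subset by blast
  then show ?thesis
    using lifts_pivot_connected[OF X(1) Y(1)] X(2) Y(2) by simp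
qed

end

section \<open>From the graph hypothesis to the pivot property\<close>

lemma four_cycle_free_graphI:
  assumes "four_cycle_free H"
  shows "four_cycle_free_graph H"
proof -
  have H: "pair_graph H" and free: "\<not> contains_subgraph H cycle4"
    using assms by (auto simp: four_cycle_free_def)
  interpret pair_graph H by fact
  show ?thesis
  proof
    fix a b c d
    assume arcs: "(a, b) \<in> parcs H" "(b, c) \<in> parcs H" "(c, d) \<in> parcs H" "(d, a) \<in> parcs H"
    from arcs[THEN no_loops] have "a \<noteq> b" "b \<noteq> c" "c \<noteq> d" "d \<noteq> a"
      by simp_all
    then show "a = c \<or> b = d"
      using free arcs unfolding contains_cycle4_iff[OF H] by auto
  qed
qed

theorem theorem4p1:
  fixes H :: "'v pair_pre_digraph"
  assumes "CARD('d::finite) \<ge> 2"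
    and "four_cycle_free H"
  shows "pivot_property (hom_shift H :: (int ^ 'd \<Rightarrow> 'v) set)"
  unfolding pivot_property_def
proof (intro ballI impI)
  interpret four_cycle_free_graph H by (rule four_cycle_free_graphI) fact
  fix x y :: "int ^ 'd \<Rightarrow> 'v"
  assume x: "x \<in> hom_shift H" and y: "y \<in> hom_shift H" and "x \<noteq> y \<and> finite (diff_sites x y)"
  then have "(x, y) \<in> pivot\<^sup>*"
    using hom_shift_pivot_connected assms(1) by blast
  then obtain n where "(x, y) \<in> pivot ^^ n"
    using rtrancl_imp_relpow by blast
  then obtain f where f: "f 0 = x" "f n = y" "\<And>i. i < n \<Longrightarrow> (f i, f (Suc i)) \<in> pivot"
    unfolding relpow_fun_conv by blast
  \<comment> \<open>The required sequence is indexed from 1, the relation power from 0.\<close>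
  let ?z = "\<lambda>m. f (m - 1)"
  have "?z m \<in> hom_shift H" if "m \<in> {1..n + 1}" for m
  \<comment> \<open>The last term is the source of no pivot in the chain, so it is handled through
    \<open>y\<close>; this also covers \<open>n = 0\<close>.\<close>
  proof (cases "m = n + 1")
    case True
    then show ?thesis using f(2) y by simp
  next
    case False
    then show ?thesis using that f(3)[of "m - 1"] by (auto simp: pivot_def)
  qed
  moreover have "card (diff_sites (?z m) (?z (m + 1))) = 1" if "m \<in> {1..<n + 1}" for m
    using that f(3)[of "m - 1"] by (auto simp: pivot_def)
  ultimately show "\<exists>k::nat. \<exists>z. 1 \<le> k \<and> z 1 = x \<and> z k = y \<and> (\<forall>n\<in>{1..k}. z n \<in> hom_shift H) \<and>
      (\<forall>n\<in>{1..<k}. card (diff_sites (z n) (z (n + 1))) = 1)"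
    using f(1,2) by (intro exI[of _ "n + 1"] exI[of _ ?z]) auto
qed

end
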